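(* Let $G$ be a finitely generated group with finite generating subset $S$, and assume that $G$ has a finite index normal subgroup $N$ with a finite generating subset $S'$. (1) For any finitely generated separable subgroup $H \le G$ of infinite index, $$\mathrm{F}_{N,N \cap H,S'}(n) \preceq \mathrm{F}_{G,H,S} (n) \preceq \left( \mathrm{F}_{N, N\cap H, S'} (n) \right)^{[G:N]^2}.$$ (2) If $G$ is subgroup separable and $N$ is nontrivial, then $$\mathrm{Sub}_{N,S'}(n) \preceq \mathrm{Sub}_{G,S} (n) \preceq \left( \mathrm{Sub}_{N, S'} (n) \right)^{[G:N]^2}.$$
   Context: $\mathbb{N}=\{1,2,\dots\}$. For a group $G$ with finite generating subset $S$, $\|g\|_S$ denotes the word length of $g\in G$ with respect to $S$. For a finite subset $X\subseteq G$, $\|X\|_S=\max\{\|x\|_S : x\in X\}$, and for a finitely generated subgroup $H\le G$, $\|H\|_S=\min\{\|X\|_S : X \text{ is a finite generating subset for } H\}$. For a group $G$, a proper subgroup $H$ and $g \in G\setminus H$, set $\mathrm{D}_G(H,g) = \min\{|Q| : Q \text{ is a finite group and there is a group morphism } \pi: G\to Q \text{ with } \pi(g)\notin\pi(H)\}$, with value $\infty$ if no such $Q$ exists. A finitely generated subgroup $H$ is separable in $G$ if $\mathrm{D}_G(H,g)<\infty$ for all $g\in G\setminus H$; $G$ is subgroup separable if all its finitely generated subgroups are separable. For a proper, finitely generated, separable subgroup $H \le G$, set $\mathrm{F}_{G,H,S}(n) = \max\{\mathrm{D}_G(H,g) : g\in G\setminus H,\ \|g\|_S\le n\}$ for $n\in\mathbb{N}$.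 For a finitely generated subgroup separable group $G$, set $\mathrm{Sub}_{G,S}(n)=\max\{\mathrm{D}_G(H,g) : H\le G \text{ finitely generated},\ g\in G\setminus H,\ \|H\|_S\le n,\ \|g\|_S\le n\}$ for $n\in\mathbb{N}$. For non-decreasing functions $f,g$ on $\mathbb{N}$, $f(n)\preceq g(n)$ means there is $C\in\mathbb{N}$ with $f(n)\le C\,g(Cn)$ for all $n$. *)

theory Defs
  imports "HOL-Algebra.Generated_Groups" "HOL-Library.Extended_Nat"
begin

definition finite_gen_set :: "('a, 'b) monoid_scheme \<Rightarrow> 'a set \<Rightarrow> bool" where
  "finite_gen_set G S \<longleftrightarrow> finite S \<and> S \<subseteq> carrier G \<and> generate G S = carrier G"

definition fg_subgroup :: "('a, 'b) monoid_scheme \<Rightarrow> 'a set \<Rightarrow> bool" where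
  "fg_subgroup G H \<longleftrightarrow> subgroup H G \<and> (\<exists>X. finite X \<and> X \<subseteq> H \<and> generate G X = H)"

text \<open>Words are over S together with the inverses of its elements. The value is meaningful for
  the elements of the subgroup generated by S.\<close>

definition word_length :: "('a, 'b) monoid_scheme \<Rightarrow> 'a set \<Rightarrow> 'a \<Rightarrow> nat" where
  "word_length G S g =
     (LEAST k. \<exists>ws. set ws \<subseteq> S \<union> m_inv G ` S \<and> length ws = k \<and> foldr (mult G) ws (one G) = g)"

text \<open>The inserted 0 only fixes the maximum over the empty set.\<close>

definition set_length :: "('a, 'b) monoid_scheme \<Rightarrow> 'a set \<Rightarrow> 'a set \<Rightarrow> nat" where
  "set_length G S X = Max (insert 0 (word_length G S ` X))"

definition subgroup_length :: "('a, 'b) monoid_scheme \<Rightarrow> 'a set \<Rightarrow> 'a set \<Rightarrow> nat" where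
  "subgroup_length G S H =
     (LEAST m. \<exists>X. finite X \<and> X \<subseteq> H \<and> generate G X = H \<and> set_length G S X = m)"

text \<open>Every finite group has an isomorphic copy whose carrier is a set of natural numbers, so
  letting Q range over groups on nat loses no finite group; see \<open>sep_depth_le\<close> below.
  The infimum of a nonempty set of extended naturals is attained, and that of the empty set
  is \<open>\<infinity>\<close>.\<close>

definition sep_depth :: "('a, 'b) monoid_scheme \<Rightarrow> 'a set \<Rightarrow> 'a \<Rightarrow> enat" where
  "sep_depth G H g =
     Inf {enat (order Q) | (Q :: nat monoid) \<pi>.
       group Q \<and> finite (carrier Q) \<and> \<pi> \<in> hom G Q \<and> \<pi> g \<notin> \<pi> ` H}"

lemma sep_depth_le:
  fixes Q :: "('c, 'd) monoid_scheme"
  assumes Q: "group Q" and fin: "finite (carrier Q)" and G: "group G"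
    and pi: "\<pi> \<in> hom G Q" and H: "H \<subseteq> carrier G" and g: "g \<in> carrier G" and sep: "\<pi> g \<notin> \<pi> ` H"
  shows "sep_depth G H g \<le> enat (order Q)"
proof -
  interpret Q: group Q by (rule Q)
  obtain f :: "'c \<Rightarrow> nat" where f: "inj_on f (carrier Q)"
    using finite_imp_inj_to_nat_seg[OF fin] by blast
  define h where "h = inv_into (carrier Q) f"
  have hf [simp]: "h (f x) = x" if "x \<in> carrier Q" for x
    using f that by (simp add: h_def)
  define R :: "nat monoid"
    where "R = \<lparr>carrier = f ` carrier Q, mult = (\<lambda>x y. f (h x \<otimes>\<^bsub>Q\<^esub> h y)), one = f \<one>\<^bsub>Q\<^esub>\<rparr>"
  have "group R"
  proof (rule groupI)
    show "\<exists>y\<in>carrier R. y \<otimes>\<^bsub>R\<^esub> x = \<one>\<^bsub>R\<^esub>" if "x \<in> carrier R" for x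
      using that by (auto simp: R_def intro!: bexI[of _ "inv\<^bsub>Q\<^esub> _"])
  qed (auto simp: R_def Q.m_assoc)
  moreover have "finite (carrier R)" by (simp add: R_def fin)
  moreover have "f \<circ> \<pi> \<in> hom G R"
    using pi by (auto simp: hom_def R_def Pi_iff)
  moreover have "(f \<circ> \<pi>) g \<notin> (f \<circ> \<pi>) ` H"
    using sep pi H g f by (auto simp: hom_def Pi_iff dest!: inj_onD)
  moreover have "order R = order Q"
    by (simp add: R_def order_def card_image f)
  ultimately show ?thesis
    unfolding sep_depth_def by (intro Inf_lower CollectI exI[of _ R] exI[of _ "f \<circ> \<pi>"]) auto
qed

definition separable_subgroup :: "('a, 'b) monoid_scheme \<Rightarrow> 'a set \<Rightarrow> bool" where
  "separable_subgroup G H \<longleftrightarrow> (\<forall>g \<in> carrier G - H. sep_depth G H g < \<infinity>)"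

definition subgroup_separable :: "('a, 'b) monoid_scheme \<Rightarrow> bool" where
  "subgroup_separable G \<longleftrightarrow> (\<forall>H. fg_subgroup G H \<longrightarrow> separable_subgroup G H)"

text \<open>The maxima below are taken over finite sets when S is a finite generating set. The first one is
  over a nonempty set for n at least 1 if H is proper, the second one if the group is nontrivial.\<close>

definition F_growth :: "('a, 'b) monoid_scheme \<Rightarrow> 'a set \<Rightarrow> 'a set \<Rightarrow> nat \<Rightarrow> enat" where
  "F_growth G H S n = Max {sep_depth G H g | g. g \<in> carrier G - H \<and> word_length G S g \<le> n}"

definition Sub_growth :: "('a, 'b) monoid_scheme \<Rightarrow> 'a set \<Rightarrow> nat \<Rightarrow> enat" where
  "Sub_growth G S n = Max {sep_depth G H g | H g. fg_subgroup G H \<and> g \<in> carrier G - H \<and>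
     subgroup_length G S H \<le> n \<and> word_length G S g \<le> n}"

text \<open>Growth functions have domain the positive integers.\<close>

definition growth_le :: "(nat \<Rightarrow> enat) \<Rightarrow> (nat \<Rightarrow> enat) \<Rightarrow> bool" (infix \<open>\<preceq>\<close> 50) where
  "f \<preceq> g \<longleftrightarrow> (\<exists>C::nat. C \<ge> 1 \<and> (\<forall>n\<ge>1. f n \<le> enat C * g (C * n)))"

end

theory Submission
  imports Defs
begin

text \<open>Let \<open>d\<close> be the index of \<open>N\<close>. Word lengths on \<open>N\<close> with respect to \<open>S\<close> and \<open>S'\<close> agree up to a
  constant factor: one direction is a change of generators, the other is Schreier's rewriting
  process (\<open>schreier\<close>, \<open>finite_index_undistorted\<close>). A homomorphism on \<open>G\<close> that separates an element
  of \<open>N\<close> from \<open>H\<close> restricts to one on \<open>N\<close> that separates it from \<open>N \<inter> H\<close>, and this gives the lower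
  bounds.

  For the upper bounds, let \<open>g\<close> lie outside \<open>H\<close>. If \<open>g\<close> is outside \<open>N H\<close>, the quotient \<open>G / N\<close> of
  order \<open>d\<close> separates it from \<open>H\<close>. Otherwise \<open>g = k h\<close> with \<open>k \<in> N\<close> and \<open>h \<in> H\<close>, and separating \<open>g\<close>
  from \<open>H\<close> is the same as separating \<open>k\<close>. A finite quotient of \<open>N\<close> of order \<open>D\<close> that separates \<open>k\<close>
  from \<open>N \<inter> H\<close> yields a quotient of \<open>G\<close> of order at most \<open>d D\<^sup>d\<close> that separates \<open>k\<close> from \<open>H\<close>
  (\<open>sep_depth_le_power\<close>), which is at most \<open>d\<close> times the \<open>d\<^sup>2\<close>-th power of \<open>D\<close>.

  It remains to keep lengths linear. The element \<open>h\<close> may be any element of \<open>H\<close> in the coset \<open>N g\<close>. For a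
  fixed \<open>H\<close> it comes from a finite set of representatives. When \<open>H\<close> varies with generators of length at
  most \<open>n\<close>, every coset of \<open>N\<close> that meets \<open>H\<close> contains a product of fewer than \<open>d\<close> generators
  (\<open>short_representative\<close>), and \<open>N \<inter> H\<close> is generated by products of at most \<open>2 d + 1\<close> generators of \<open>H\<close>
  (\<open>finite_index_intersection\<close>).\<close>

section \<open>Words and word length\<close>

context group
begin

definition word_prod :: "'a list \<Rightarrow> 'a" where
  "word_prod ws = foldr (\<otimes>) ws \<one>"

lemma word_prod_simps [simp]: "word_prod [] = \<one>" "word_prod (w # ws) = w \<otimes> word_prod ws"
  by (simp_all add: word_prod_def)

abbreviation letters :: "'a set \<Rightarrow> 'a set" where
  "letters S \<equiv> S \<union> m_inv G ` S"

lemma letters_subset_carrier: "S \<subseteq> carrier G \<Longrightarrow> letters S \<subseteq> carrier G"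
  by auto

lemma letters_subset_generate: "letters S \<subseteq> generate G S"
  by (auto intro: generate.incl generate.inv)

lemma word_prod_closed: "set ws \<subseteq> carrier G \<Longrightarrow> word_prod ws \<in> carrier G"
  by (induction ws) auto

lemma word_prod_append:
  "set us \<subseteq> carrier G \<Longrightarrow> set vs \<subseteq> carrier G \<Longrightarrow> word_prod (us @ vs) = word_prod us \<otimes> word_prod vs"
  by (induction us) (auto simp: m_assoc word_prod_closed)

lemma word_prod_in_generate: "set ws \<subseteq> letters S \<Longrightarrow> word_prod ws \<in> generate G S"
  using letters_subset_generate[of S] by (induction ws) (auto intro: generate.one generate.eng)

lemma generate_word:
  assumes S: "S \<subseteq> carrier G" and g: "g \<in> generate G S"
  shows "\<exists>ws. set ws \<subseteq> letters S \<and> word_prod ws = g"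
  using g
proof induction
  case one
  show ?case by (rule exI[of _ "[]"]) simp
next
  case (incl h)
  then show ?case using S by (intro exI[of _ "[h]"]) auto
next
  case (inv h)
  then show ?case using S by (intro exI[of _ "[inv h]"]) auto
next
  case (eng g h)
  then obtain us vs where "set us \<subseteq> letters S" "word_prod us = g"
    "set vs \<subseteq> letters S" "word_prod vs = h" by auto
  moreover from this have "set us \<subseteq> carrier G" "set vs \<subseteq> carrier G"
    using letters_subset_carrier[OF S] by auto
  ultimately show ?case by (intro exI[of _ "us @ vs"]) (simp add: word_prod_append)
qed

lemma word_length_le: "set ws \<subseteq> letters S \<Longrightarrow> word_length G S (word_prod ws) \<le> length ws"
  unfolding word_length_def word_prod_def by (rule Least_le) blast

lemma shortest_word:
  assumes S: "S \<subseteq> carrier G" and g: "g \<in> generate G S"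
  obtains ws where "set ws \<subseteq> letters S" "word_prod ws = g" "length ws = word_length G S g"
proof -
  have "\<exists>k ws. set ws \<subseteq> letters S \<and> length ws = k \<and> word_prod ws = g"
    using generate_word[OF assms] by auto
  from LeastI_ex[OF this] show thesis
    using that unfolding word_length_def word_prod_def by blast
qed

lemma word_length_one: "word_length G S \<one> = 0"
  using word_length_le[of "[]" S] by simp

lemma word_length_letter:
  assumes "S \<subseteq> carrier G" "s \<in> letters S"
  shows "word_length G S s \<le> 1"
proof -
  have "s \<in> carrier G" using assms by auto
  then show ?thesis using word_length_le[of "[s]" S] assms by simp
qed

lemma word_length_mult:
  assumes S: "S \<subseteq> carrier G" and g: "g \<in> generate G S" and h: "h \<in> generate G S"
  shows "word_length G S (g \<otimes> h) \<le> word_length G S g + word_length G S h"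
proof -
  obtain us where us: "set us \<subseteq> letters S" "word_prod us = g" "length us = word_length G S g"
    using shortest_word[OF S g] .
  obtain vs where vs: "set vs \<subseteq> letters S" "word_prod vs = h" "length vs = word_length G S h"
    using shortest_word[OF S h] .
  have "set us \<subseteq> carrier G" "set vs \<subseteq> carrier G"
    using us vs letters_subset_carrier[OF S] by auto
  then show ?thesis
    using word_length_le[of "us @ vs" S] us vs by (simp add: word_prod_append)
qed

lemma word_length_inv:
  assumes S: "S \<subseteq> carrier G" and g: "g \<in> generate G S"
  shows "word_length G S (inv g) \<le> word_length G S g"
proof -
  obtain us where us: "set us \<subseteq> letters S" "word_prod us = g" "length us = word_length G S g"
    using shortest_word[OF S g] .
  have "word_length G S (inv (word_prod ws)) \<le> length ws" if "set ws \<subseteq> letters S" for ws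
    using that
  proof (induction ws)
    case (Cons a ws)
    have w: "word_prod ws \<in> generate G S" and a: "a \<in> generate G S"
      using Cons.prems letters_subset_generate[of S] word_prod_in_generate[of ws S] by auto
    have carr: "a \<in> carrier G" "word_prod ws \<in> carrier G"
      using a w generate_in_carrier[OF S] by auto
    have "inv a \<in> letters S"
    proof (cases "a \<in> S")
      case False
      then obtain x where "x \<in> S" "a = inv x" using Cons.prems by auto
      then show ?thesis using S by (simp add: subset_iff)
    qed blast
    then have "word_length G S (inv (word_prod ws) \<otimes> inv a) \<le> word_length G S (inv (word_prod ws)) + 1"
      using word_length_mult[OF S generate_m_inv_closed[OF S w] generate_m_inv_closed[OF S a]]
        word_length_letter[OF S, of "inv a"] by linarith
    with Cons carr show ?case by (simp add: inv_mult_group)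
  qed (simp add: word_length_one)
  from this[OF us(1)] show ?thesis unfolding us(2,3) .
qed

lemma finite_word_ball:
  assumes S: "S \<subseteq> carrier G" and fin: "finite S"
  shows "finite {g \<in> generate G S. word_length G S g \<le> n}"
proof (rule finite_subset)
  show "{g \<in> generate G S. word_length G S g \<le> n} \<subseteq>
      word_prod ` {ws. set ws \<subseteq> letters S \<and> length ws \<le> n}"
  proof safe
    fix g assume g: "g \<in> generate G S" "word_length G S g \<le> n"
    obtain ws where "set ws \<subseteq> letters S" "word_prod ws = g" "length ws = word_length G S g"
      using shortest_word[OF S g(1)] .
    with g(2) show "g \<in> word_prod ` {ws. set ws \<subseteq> letters S \<and> length ws \<le> n}" by auto
  qed
  show "finite (word_prod ` {ws. set ws \<subseteq> letters S \<and> length ws \<le> n})"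
    using fin by (intro finite_imageI finite_lists_length_le) auto
qed

lemma word_length_change_generators:
  assumes S: "S \<subseteq> carrier G" and X: "X \<subseteq> generate G S"
    and c: "\<And>x. x \<in> X \<Longrightarrow> word_length G S x \<le> c" and g: "g \<in> generate G X"
  shows "word_length G S g \<le> c * word_length G X g"
proof -
  have XG: "X \<subseteq> carrier G" using X generate_incl[OF S] by blast
  have "word_prod ws \<in> generate G S \<and> word_length G S (word_prod ws) \<le> c * length ws"
    if "set ws \<subseteq> letters X" for ws
    using that
  proof (induction ws)
    case (Cons a ws)
    have a: "a \<in> generate G S"
      using Cons.prems X generate_m_inv_closed[OF S] by auto
    have "word_length G S a \<le> c"
    proof (cases "a \<in> X")
      case False
      then obtain x where x: "x \<in> X" "a = inv x" using Cons.prems by auto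
      then show ?thesis using word_length_inv[OF S, of x] X c[of x] by fastforce
    qed (rule c)
    moreover have w: "word_prod ws \<in> generate G S" "word_length G S (word_prod ws) \<le> c * length ws"
      using Cons by auto
    ultimately show ?case
      using a word_length_mult[OF S a w(1)] by (simp add: generate.eng)
  qed (auto simp: word_length_one generate.one)
  moreover obtain ws where "set ws \<subseteq> letters X" "word_prod ws = g" "length ws = word_length G X g"
    using shortest_word[OF XG g] .
  ultimately show ?thesis by metis
qed

end

section \<open>Schreier generators\<close>

text \<open>Moving a word letter by letter past coset representatives writes it as a representative
  times a product of at most as many Schreier generators, one for each letter. The representative
  is trivial for an element of the kernel. So the rewriting does not lengthen words, which is what
  makes the kernel undistorted up to a constant.\<close>

lemma (in group_hom) schreier:
  assumes X: "X \<subseteq> carrier G"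
    and r: "\<And>q. q \<in> h ` generate G X \<Longrightarrow> r q \<in> generate G X \<and> h (r q) = q"
    and r1: "r \<one>\<^bsub>H\<^esub> = \<one>"
  defines "Y \<equiv> {inv (r (h (x \<otimes> r q))) \<otimes> (x \<otimes> r q) | x q. x \<in> G.letters X \<and> q \<in> h ` generate G X}"
  shows "Y \<subseteq> generate G X" "Y \<subseteq> kernel G H h"
    and "g \<in> generate G X \<Longrightarrow> h g = \<one>\<^bsub>H\<^esub> \<Longrightarrow>
      g \<in> generate G Y \<and> word_length G Y g \<le> word_length G X g"
proof -
  note gen_carr = subsetD[OF G.generate_incl[OF X]]
  note gen_inv = G.generate_m_inv_closed[OF X]
  have rc: "r (h a) \<in> generate G X" "h (r (h a)) = h a" if "a \<in> generate G X" for a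
    using r that by auto
  have step: "x \<otimes> r q \<in> generate G X" if "x \<in> G.letters X" "q \<in> h ` generate G X" for x q
    using that r[of q] G.letters_subset_generate[of X] by (auto intro: generate.eng)
  show YX: "Y \<subseteq> generate G X"
  proof
    fix y assume "y \<in> Y"
    then obtain x q where xq: "x \<in> G.letters X" "q \<in> h ` generate G X"
      and y: "y = inv (r (h (x \<otimes> r q))) \<otimes> (x \<otimes> r q)" unfolding Y_def by blast
    show "y \<in> generate G X"
      unfolding y using step[OF xq] rc(1) gen_inv by (blast intro: generate.eng)
  qed
  show "Y \<subseteq> kernel G H h"
  proof
    fix y assume "y \<in> Y"
    then obtain x q where xq: "x \<in> G.letters X" "q \<in> h ` generate G X"
      and y: "y = inv (r (h (x \<otimes> r q))) \<otimes> (x \<otimes> r q)" unfolding Y_def by blast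
    define a where "a = x \<otimes> r q"
    have a: "a \<in> generate G X" using step xq by (simp add: a_def)
    have "r (h a) \<in> carrier G" "a \<in> carrier G" "h (r (h a)) = h a"
      using rc[OF a] a gen_carr by auto
    then show "y \<in> kernel G H h"
      by (simp add: y kernel_def flip: a_def)
  qed
  have YG: "Y \<subseteq> carrier G" using YX gen_carr by blast
  have rewrite: "\<exists>vs. set vs \<subseteq> G.letters Y \<and> length vs \<le> length ws \<and>
      G.word_prod ws = r (h (G.word_prod ws)) \<otimes> G.word_prod vs"
    if "set ws \<subseteq> G.letters X" for ws
    using that
  proof (induction ws)
    case Nil
    show ?case by (intro exI[of _ "[]"]) (simp add: r1)
  next
    case (Cons x ws)
    then obtain vs where vs: "set vs \<subseteq> G.letters Y" "length vs \<le> length ws"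
      and eq: "G.word_prod ws = r (h (G.word_prod ws)) \<otimes> G.word_prod vs" by auto
    define w v where "w = G.word_prod ws" and "v = G.word_prod vs"
    have w: "w \<in> generate G X"
      unfolding w_def using Cons.prems by (intro G.word_prod_in_generate) auto
    have x: "x \<in> G.letters X" using Cons.prems by auto
    define a where "a = x \<otimes> r (h w)"
    have a: "a \<in> generate G X" using step x w by (simp add: a_def)
    have mem: "r (h w) \<in> carrier G" "w \<in> carrier G" "x \<in> carrier G" "a \<in> carrier G"
        "r (h a) \<in> carrier G" "v \<in> carrier G"
      using rc[OF w] rc[OF a] a w gen_carr subsetD[OF G.letters_subset_carrier[OF X] x]
        G.word_prod_closed[OF order_trans[OF vs(1) G.letters_subset_carrier[OF YG]]]
      by (simp_all add: v_def)
    have "h a = h (x \<otimes> w)"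
      using mem rc[OF w] by (simp add: a_def)
    moreover have "x \<otimes> w = r (h a) \<otimes> (inv (r (h a)) \<otimes> a \<otimes> v)"
    proof -
      have "r (h a) \<otimes> (inv (r (h a)) \<otimes> a \<otimes> v) = a \<otimes> v"
        using mem by (simp flip: G.m_assoc)
      also have "\<dots> = x \<otimes> w"
        unfolding a_def using mem eq by (simp add: G.m_assoc flip: w_def v_def)
      finally show ?thesis by simp
    qed
    moreover have "inv (r (h a)) \<otimes> a \<in> Y"
      unfolding Y_def a_def using x w by blast
    ultimately show ?case
      using vs by (intro exI[of _ "(inv (r (h a)) \<otimes> a) # vs"]) (simp add: w_def v_def)
  qed
  show "g \<in> generate G Y \<and> word_length G Y g \<le> word_length G X g"
    if g: "g \<in> generate G X" "h g = \<one>\<^bsub>H\<^esub>"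
  proof -
    obtain ws where ws: "set ws \<subseteq> G.letters X" "G.word_prod ws = g" "length ws = word_length G X g"
      using G.shortest_word[OF X g(1)] .
    obtain vs where vs: "set vs \<subseteq> G.letters Y" "length vs \<le> length ws" "g = r (h g) \<otimes> G.word_prod vs"
      using rewrite[OF ws(1)] ws(2) by auto
    have "G.word_prod vs \<in> carrier G"
      using vs(1) YG by (auto intro!: G.word_prod_closed)
    then have "g = G.word_prod vs" using vs(3) g r1 by simp
    then show ?thesis
      using vs ws G.word_length_le[OF vs(1)] G.word_prod_in_generate[OF vs(1)] by simp
  qed
qed

text \<open>If a word has at least as many letters as the finite group has elements, two of its suffixes
  have the same image, and cutting out the part between them leaves the image of the word
  unchanged.\<close>

lemma (in group_hom) short_representative:
  assumes X: "X \<subseteq> carrier G" and fin: "finite (carrier H)" and g: "g \<in> generate G X"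
  obtains g' where "g' \<in> generate G X" "h g' = h g" "word_length G X g' < order H"
proof -
  define P where "P ws \<longleftrightarrow> set ws \<subseteq> G.letters X \<and> h (G.word_prod ws) = h g" for ws
  obtain ws0 where "P ws0" using G.generate_word[OF X g] by (auto simp: P_def)
  define ws where "ws = arg_min length P"
  have ws: "P ws" unfolding ws_def using \<open>P ws0\<close> by (rule arg_min_natI)
  have min: "length ws \<le> length vs" if "P vs" for vs
    unfolding ws_def using that by (rule arg_min_nat_le)
  have wsG: "set ws \<subseteq> carrier G"
    using ws G.letters_subset_carrier[OF X] unfolding P_def by (elim conjE) (rule order_trans)
  have carr: "G.word_prod vs \<in> carrier G" if "set vs \<subseteq> set ws" for vs
    using order_trans[OF that wsG] by (rule G.word_prod_closed)
  have "length ws < order H"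
  proof (rule ccontr)
    assume long: "\<not> length ws < order H"
    define f where "f i = h (G.word_prod (drop i ws))" for i
    have "f ` {0..length ws} \<subseteq> carrier H"
      unfolding f_def by (intro image_subsetI hom_closed carr set_drop_subset)
    then have "card (f ` {0..length ws}) \<le> order H"
      unfolding order_def using fin by (rule card_mono[rotated])
    then have "\<not> inj_on f {0..length ws}"
      using long card_image[of f "{0..length ws}"] by auto
    then obtain a b where ab: "a \<le> length ws" "b \<le> length ws" "a \<noteq> b" "f a = f b"
      unfolding inj_on_def by auto
    define i j where "i = min a b" and "j = max a b"
    have ij: "i < j" "j \<le> length ws" "f i = f j"
      using ab by (auto simp: i_def j_def min_def max_def)
    define vs where "vs = take i ws @ drop j ws"
    have sub: "set (take i ws) \<subseteq> carrier G" "set (drop i ws) \<subseteq> carrier G" "set (drop j ws) \<subseteq> carrier G"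
      using ws X by (auto simp: P_def dest!: in_set_takeD in_set_dropD)
    have "h (G.word_prod vs) = h (G.word_prod (take i ws)) \<otimes>\<^bsub>H\<^esub> f j"
      unfolding vs_def f_def using sub by (simp add: G.word_prod_append G.word_prod_closed)
    also have "\<dots> = h (G.word_prod (take i ws @ drop i ws))"
      unfolding ij(3)[symmetric] unfolding f_def
      using sub by (simp add: G.word_prod_append G.word_prod_closed del: append_take_drop_id)
    finally have "P vs"
      using ws by (auto simp: P_def vs_def dest!: in_set_takeD in_set_dropD)
    from min[OF this] ij show False by (simp add: vs_def)
  qed
  then show thesis
    using ws that[of "G.word_prod ws"] G.word_length_le[of ws X] G.word_prod_in_generate[of ws X]
    by (auto simp: P_def)
qed

section \<open>Separation depth\<close>

lemma sep_depth_attained: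
  assumes "sep_depth G H g \<noteq> \<infinity>"
  obtains Q :: "nat monoid" and \<pi> where "group Q" "finite (carrier Q)" "\<pi> \<in> hom G Q"
    "\<pi> g \<notin> \<pi> ` H" "sep_depth G H g = enat (order Q)"
proof -
  let ?A = "{enat (order Q) | (Q :: nat monoid) \<pi>.
       group Q \<and> finite (carrier Q) \<and> \<pi> \<in> hom G Q \<and> \<pi> g \<notin> \<pi> ` H}"
  have "?A \<noteq> {}"
  proof
    assume "?A = {}"
    then have "sep_depth G H g = \<infinity>"
      unfolding sep_depth_def by (simp only: Inf_enat_def simp_thms if_True)
    with assms show False by blast
  qed
  then have "Inf ?A \<in> ?A"
    unfolding Inf_enat_def using LeastI_ex[of "\<lambda>x. x \<in> ?A"] by auto
  then have "sep_depth G H g \<in> ?A" by (simp add: sep_depth_def)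
  then show thesis using that by blast
qed

lemma sep_depth_ge_1: "1 \<le> sep_depth G H g"
proof (cases "sep_depth G H g = \<infinity>")
  case False
  then obtain Q :: "nat monoid" where "group Q" "finite (carrier Q)" "sep_depth G H g = enat (order Q)"
    using sep_depth_attained by metis
  then show ?thesis
    using monoid.order_gt_0_iff_finite[of Q] by (simp add: one_enat_def group.is_monoid Suc_le_eq)
qed simp

lemma sep_depth_restrict:
  assumes "N \<subseteq> carrier G" "K \<subseteq> H"
  shows "sep_depth (G\<lparr>carrier := N\<rparr>) K g \<le> sep_depth G H g"
  unfolding sep_depth_def
proof (rule Inf_superset_mono, safe)
  fix Q :: "nat monoid" and \<pi>
  assume "group Q" "finite (carrier Q)" "\<pi> \<in> hom G Q" "\<pi> g \<notin> \<pi> ` H"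
  moreover from this have "\<pi> \<in> hom (G\<lparr>carrier := N\<rparr>) Q"
    using assms(1) by (auto simp: hom_def Pi_iff subset_iff)
  ultimately show "\<exists>Q' \<pi>'. enat (order Q) = enat (order Q') \<and> group (Q' :: nat monoid) \<and>
      finite (carrier Q') \<and> \<pi>' \<in> hom (G\<lparr>carrier := N\<rparr>) Q' \<and> \<pi>' g \<notin> \<pi>' ` K"
    using assms(2) by blast
qed

text \<open>A homomorphism \<open>\<pi>\<close> maps \<open>g\<close> into the subgroup \<open>\<pi>(H)\<close> exactly if it maps \<open>g h\<close> there, so it
  separates both from \<open>H\<close> or neither.\<close>

lemma sep_depth_mult_right:
  assumes G: "group G" and H: "subgroup H G" and g: "g \<in> carrier G" and h: "h \<in> H"
  shows "sep_depth G H g \<le> sep_depth G H (g \<otimes>\<^bsub>G\<^esub> h)"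
  unfolding sep_depth_def
proof (rule Inf_superset_mono, safe)
  fix Q :: "nat monoid" and \<pi>
  assume Q: "group Q" "finite (carrier Q)" and \<pi>: "\<pi> \<in> hom G Q"
    and sep: "\<pi> (g \<otimes>\<^bsub>G\<^esub> h) \<notin> \<pi> ` H"
  have "\<pi> g \<notin> \<pi> ` H"
  proof
    assume "\<pi> g \<in> \<pi> ` H"
    then obtain a where a: "a \<in> H" "\<pi> g = \<pi> a" by auto
    have "\<pi> (g \<otimes>\<^bsub>G\<^esub> h) = \<pi> (a \<otimes>\<^bsub>G\<^esub> h)"
      using a h g subgroup.mem_carrier[OF H] by (simp add: hom_mult[OF \<pi>])
    moreover have "a \<otimes>\<^bsub>G\<^esub> h \<in> H" using a h by (intro subgroup.m_closed[OF H])
    ultimately show False using sep by blast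
  qed
  with Q \<pi> show "\<exists>Q' \<pi>'. enat (order Q) = enat (order Q') \<and> group (Q' :: nat monoid) \<and>
      finite (carrier Q') \<and> \<pi>' \<in> hom G Q' \<and> \<pi>' g \<notin> \<pi>' ` H"
    by blast
qed

lemma sep_depth_le_normal:
  assumes M: "M \<lhd> G" and fin: "finite (rcosets\<^bsub>G\<^esub> M)" and H: "subgroup H G"
    and g: "g \<in> carrier G" and sep: "\<And>h. h \<in> H \<Longrightarrow> g \<otimes>\<^bsub>G\<^esub> inv\<^bsub>G\<^esub> h \<notin> M"
  shows "sep_depth G H g \<le> enat (card (rcosets\<^bsub>G\<^esub> M))"
proof -
  interpret M: normal M G by (rule M)
  let ?\<pi> = "\<lambda>x. M #>\<^bsub>G\<^esub> x"
  have "?\<pi> g \<notin> ?\<pi> ` H"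
  proof
    assume "?\<pi> g \<in> ?\<pi> ` H"
    then obtain h where h: "h \<in> H" "M #>\<^bsub>G\<^esub> g = M #>\<^bsub>G\<^esub> h" by auto
    have "h \<in> carrier G" using h subgroup.mem_carrier[OF H] by auto
    then have "g \<otimes>\<^bsub>G\<^esub> inv\<^bsub>G\<^esub> h \<in> M"
      using h(2) g M.rcos_module_imp[OF M.is_group, of h g] M.rcos_self[OF g M.subgroup_axioms] by auto
    with sep h show False by blast
  qed
  then have "sep_depth G H g \<le> enat (order (G Mod M))"
    using fin g subgroup.subset[OF H]
    by (intro sep_depth_le[where \<pi> = ?\<pi>])
      (simp_all add: M.factorgroup_is_group M.is_group M.r_coset_hom_Mod \<open>?\<pi> g \<notin> ?\<pi> ` H\<close>, simp add: FactGroup_def)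
  then show ?thesis by (simp add: order_def FactGroup_def)
qed


lemma finite_card_image_factor:
  assumes fin: "finite (f ` A)" and eq: "\<And>x y. x \<in> A \<Longrightarrow> y \<in> A \<Longrightarrow> f x = f y \<Longrightarrow> g x = g y"
  shows "finite (g ` A)" "card (g ` A) \<le> card (f ` A)"
proof -
  have *: "g ` A = (\<lambda>z. g (inv_into A f z)) ` f ` A"
    unfolding image_image by (rule image_cong[OF refl], rule eq) (auto simp: inv_into_into f_inv_into_f)
  show "finite (g ` A)" "card (g ` A) \<le> card (f ` A)"
    unfolding * using fin by (auto intro: card_image_le)
qed

lemma (in group) rcoset_eq_iff:
  assumes "subgroup M G" "x \<in> carrier G" "y \<in> carrier G"
  shows "M #> x = M #> y \<longleftrightarrow> x \<otimes> inv y \<in> M"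
proof -
  interpret M: subgroup M G by fact
  show ?thesis
  proof
    assume "M #> x = M #> y"
    then have "x \<in> M #> y" using rcos_self[OF assms(2,1)] by simp
    then show "x \<otimes> inv y \<in> M" using M.rcos_module_imp[OF is_group assms(3)] by simp
  next
    assume "x \<otimes> inv y \<in> M"
    then have "x \<in> M #> y" using M.rcos_module_rev[OF is_group assms(3,2)] by simp
    then show "M #> x = M #> y" using repr_independence[OF _ assms(3,1)] by simp
  qed
qed

lemma (in group) rcosets_eq_image: "rcosets M = (\<lambda>x. M #> x) ` carrier G"
  by (auto simp: RCOSETS_def)

lemma (in group) cancel_inv_left:
  assumes "a \<in> carrier G" "b \<in> carrier G"
  shows "inv a \<otimes> (a \<otimes> b) = b" "a \<otimes> (inv a \<otimes> b) = b"
  using assms by (simp_all flip: m_assoc)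

lemma enat_power: "enat a ^ n = enat (a ^ n)"
  by (induction n) (simp_all add: one_enat_def)

lemma enat_infinity_power: "0 < n \<Longrightarrow> (\<infinity> :: enat) ^ n = \<infinity>"
  by (induction n rule: nat_induct_non_zero) simp_all

text \<open>A homomorphism on \<open>N\<close> that separates \<open>k\<close> from \<open>N \<inter> H\<close> has a kernel whose normal core \<open>M\<close>
  in \<open>G\<close> still separates \<open>k\<close> from \<open>H\<close>, since \<open>M \<subseteq> N\<close>. The core is the intersection of only
  \<open>[G:N]\<close> conjugates of the kernel, one for each coset of \<open>N\<close>, which bounds its index.\<close>

lemma (in group) sep_depth_le_power:
  assumes N: "N \<lhd> G" and fin: "finite (rcosets N)" and H: "subgroup H G" and k: "k \<in> N"
  shows "sep_depth G H k \<le>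
    enat (card (rcosets N)) * sep_depth (G\<lparr>carrier := N\<rparr>) (N \<inter> H) k ^ card (rcosets N)"
proof (cases "sep_depth (G\<lparr>carrier := N\<rparr>) (N \<inter> H) k = \<infinity>")
  case True
  have "card (rcosets N) > 0"
    using fin by (auto simp: card_gt_0_iff rcosets_eq_image)
  then show ?thesis
    using True enat_infinity_power by (simp add: imult_is_infinity)
next
  case False
  then obtain Q :: "nat monoid" and \<pi> where Q: "group Q" "finite (carrier Q)"
    and \<pi>: "\<pi> \<in> hom (G\<lparr>carrier := N\<rparr>) Q" and sep: "\<pi> k \<notin> \<pi> ` (N \<inter> H)"
    and depth: "sep_depth (G\<lparr>carrier := N\<rparr>) (N \<inter> H) k = enat (order Q)"
    by (rule sep_depth_attained)
  interpret N: normal N G by (rule N)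
  interpret Q: group Q by (rule Q)
  interpret \<pi>: group_hom "G\<lparr>carrier := N\<rparr>" Q \<pi>
    using \<pi> Q(1) N.subgroup_is_group[OF is_group] by (simp add: group_hom_def group_hom_axioms_def)
  have \<pi>_closed: "\<pi> a \<in> carrier Q" if "a \<in> N" for a
    using \<pi>.hom_closed that by simp
  have \<pi>_mult: "\<pi> (a \<otimes> b) = \<pi> a \<otimes>\<^bsub>Q\<^esub> \<pi> b" if "a \<in> N" "b \<in> N" for a b
    using \<pi>.hom_mult that by simp
  have \<pi>_inv: "\<pi> (inv a) = inv\<^bsub>Q\<^esub> \<pi> a" if "a \<in> N" for a
    using \<pi>.hom_inv[of a] that m_inv_consistent[OF N.subgroup_axioms that] by simp
  have \<pi>_one: "\<pi> \<one> = \<one>\<^bsub>Q\<^esub>"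
    using \<pi>.hom_one by simp
  have conj: "x \<otimes> a \<otimes> inv x \<in> N" if "x \<in> carrier G" "a \<in> N" for x a
    using N.inv_op_closed2 that by simp
  define M where "M = {m \<in> N. \<forall>x \<in> carrier G. \<pi> (x \<otimes> m \<otimes> inv x) = \<one>\<^bsub>Q\<^esub>}"
  have conj_mult: "x \<otimes> (a \<otimes> b) \<otimes> inv x = (x \<otimes> a \<otimes> inv x) \<otimes> (x \<otimes> b \<otimes> inv x)"
    if "x \<in> carrier G" "a \<in> carrier G" "b \<in> carrier G" for x a b
    using that by (simp add: m_assoc cancel_inv_left)
  have conj_inv: "x \<otimes> inv a \<otimes> inv x = inv (x \<otimes> a \<otimes> inv x)"
    if "x \<in> carrier G" "a \<in> carrier G" for x a
    using that by (simp add: m_assoc inv_mult_group)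
  have "subgroup M G"
  proof (rule subgroupI)
    show "M \<subseteq> carrier G" unfolding M_def by auto
    have "\<one> \<in> M" unfolding M_def by (simp add: \<pi>_one)
    then show "M \<noteq> {}" by blast
    show "inv a \<in> M" if "a \<in> M" for a
      using that unfolding M_def by (auto simp: conj_inv \<pi>_inv conj)
    show "a \<otimes> b \<in> M" if "a \<in> M" "b \<in> M" for a b
      using that unfolding M_def by (auto simp: conj_mult \<pi>_mult conj)
  qed
  have "M \<lhd> G"
    unfolding normal_inv_iff
  proof (intro conjI ballI)
    fix x a assume x: "x \<in> carrier G" and a: "a \<in> M"
    have "y \<otimes> (x \<otimes> a \<otimes> inv x) \<otimes> inv y = (y \<otimes> x) \<otimes> a \<otimes> inv (y \<otimes> x)" if "y \<in> carrier G" for y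
      using that x a by (simp add: M_def m_assoc inv_mult_group)
    then show "x \<otimes> a \<otimes> inv x \<in> M"
      using x a unfolding M_def by (auto simp: conj)
  qed fact
  have "\<forall>c \<in> rcosets N. \<exists>x. x \<in> carrier G \<and> N #> x = c"
    by (auto simp: rcosets_eq_image)
  from bchoice[OF this] obtain r where "\<forall>c \<in> rcosets N. r c \<in> carrier G \<and> N #> r c = c" ..
  then have r: "r c \<in> carrier G \<and> N #> r c = c" if "c \<in> rcosets N" for c
    using that by blast
  \<comment> \<open>Conjugation by an element of \<open>N\<close> becomes inner in \<open>Q\<close>, so one conjugate per coset suffices.\<close>
  have M_test: "w \<in> M" if w: "w \<in> N" "\<And>c. c \<in> rcosets N \<Longrightarrow> \<pi> (r c \<otimes> w \<otimes> inv (r c)) = \<one>\<^bsub>Q\<^esub>" for w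
    unfolding M_def
  proof (intro CollectI conjI ballI)
    fix x assume x: "x \<in> carrier G"
    define s u where "s = r (N #> x)" and "u = x \<otimes> inv s"
    have c: "N #> x \<in> rcosets N" using x by (auto simp: rcosets_eq_image)
    have s: "s \<in> carrier G" "N #> x = N #> s" using r[OF c] by (auto simp: s_def)
    have u: "u \<in> N" unfolding u_def using s x rcoset_eq_iff[OF N.subgroup_axioms x s(1)] by simp
    have "x \<otimes> w \<otimes> inv x = u \<otimes> (s \<otimes> w \<otimes> inv s) \<otimes> inv u"
      unfolding u_def using x s w(1) by (simp add: m_assoc inv_mult_group cancel_inv_left)
    then show "\<pi> (x \<otimes> w \<otimes> inv x) = \<one>\<^bsub>Q\<^esub>"
      using u s(1) w(1) w(2)[OF c] by (simp add: \<pi>_mult \<pi>_inv conj \<pi>_closed s_def)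
  qed (rule w(1))
  \<comment> \<open>The coset of \<open>N\<close> together with all the conjugated images of the \<open>N\<close>-part determines the coset of
    \<open>M\<close>; counting the possible values bounds the index of \<open>M\<close>.\<close>
  define f where "f x = (N #> x, \<lambda>c\<in>(rcosets N). \<pi> (r c \<otimes> (x \<otimes> inv (r (N #> x))) \<otimes> inv (r c)))" for x
  have to_N: "x \<otimes> inv (r (N #> x)) \<in> N" "r (N #> x) \<in> carrier G" if "x \<in> carrier G" for x
  proof -
    have *: "r (N #> x) \<in> carrier G \<and> N #> r (N #> x) = N #> x"
      using that by (intro r) (auto simp: rcosets_eq_image)
    then show "x \<otimes> inv (r (N #> x)) \<in> N" "r (N #> x) \<in> carrier G"
      using rcoset_eq_iff[OF N.subgroup_axioms that, of "r (N #> x)"] by auto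
  qed
  have f_eq: "M #> x = M #> y" if x: "x \<in> carrier G" and y: "y \<in> carrier G" and eq: "f x = f y" for x y
  proof -
    define t where "t = r (N #> x)"
    have xy: "N #> x = N #> y" using eq by (simp add: f_def)
    define a b where "a = x \<otimes> inv t" and "b = y \<otimes> inv t"
    have t: "t \<in> carrier G" and ab: "a \<in> N" "b \<in> N"
      using to_N[OF x] to_N[OF y] xy by (simp_all add: t_def a_def b_def)
    have "a \<otimes> inv b \<in> M"
    proof (rule M_test)
      show "a \<otimes> inv b \<in> N" using ab by simp
      fix c assume c: "c \<in> rcosets N"
      have rc: "r c \<in> carrier G" using r[OF c] by simp
      have "\<pi> (r c \<otimes> a \<otimes> inv (r c)) = \<pi> (r c \<otimes> b \<otimes> inv (r c))"
        using fun_cong[OF arg_cong[OF eq, of snd], of c] c xy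
        by (simp add: f_def a_def b_def t_def)
      then show "\<pi> (r c \<otimes> (a \<otimes> inv b) \<otimes> inv (r c)) = \<one>\<^bsub>Q\<^esub>"
        using ab rc by (simp add: conj_mult conj_inv \<pi>_mult \<pi>_inv conj \<pi>_closed)
    qed
    moreover have "a \<otimes> inv b = x \<otimes> inv y"
      unfolding a_def b_def using x y t by (simp add: m_assoc inv_mult_group cancel_inv_left)
    ultimately show ?thesis
      using rcoset_eq_iff[OF \<open>subgroup M G\<close> x y] by simp
  qed
  have f_range: "f ` carrier G \<subseteq> (rcosets N) \<times> ((rcosets N) \<rightarrow>\<^sub>E carrier Q)"
    unfolding f_def using to_N r conj by (auto simp: rcosets_eq_image intro!: \<pi>_closed)
  have fin_range: "finite ((rcosets N) \<times> ((rcosets N) \<rightarrow>\<^sub>E carrier Q))"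
    using fin Q(2) by (intro finite_cartesian_product finite_PiE) auto
  note factor = finite_card_image_factor[of f "carrier G" "\<lambda>x. M #> x", OF finite_subset[OF f_range fin_range] f_eq]
  have "card (rcosets M) \<le> card (f ` carrier G)"
    unfolding rcosets_eq_image[of M] by (rule factor(2))
  also have "\<dots> \<le> card ((rcosets N) \<times> ((rcosets N) \<rightarrow>\<^sub>E carrier Q))"
    by (rule card_mono[OF fin_range f_range])
  also have "\<dots> = card (rcosets N) * order Q ^ card (rcosets N)"
    using fin by (simp add: card_cartesian_product card_PiE order_def)
  finally have index: "card (rcosets M) \<le> card (rcosets N) * order Q ^ card (rcosets N)" .
  have "sep_depth G H k \<le> enat (card (rcosets M))"
  proof (rule sep_depth_le_normal[OF \<open>M \<lhd> G\<close> _ H])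
    show "finite (rcosets M)" unfolding rcosets_eq_image[of M] by (rule factor(1))
    show kG: "k \<in> carrier G" using k by simp
    fix h assume h: "h \<in> H"
    show "k \<otimes> inv h \<notin> M"
    proof
      assume in_M: "k \<otimes> inv h \<in> M"
      have hG: "h \<in> carrier G" using h subgroup.mem_carrier[OF H] by blast
      have "inv (k \<otimes> inv h) \<otimes> k = h"
        using kG hG by (simp add: inv_mult_group m_assoc)
      moreover have "k \<otimes> inv h \<in> N" using in_M by (simp add: M_def)
      ultimately have hN: "h \<in> N" using k N.m_closed N.m_inv_closed by metis
      have "\<one> \<otimes> (k \<otimes> inv h) \<otimes> inv \<one> = k \<otimes> inv h" using kG hG by simp
      then have "\<pi> (k \<otimes> inv h) = \<one>\<^bsub>Q\<^esub>" using in_M unfolding M_def by force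
      then have "\<pi> k \<otimes>\<^bsub>Q\<^esub> inv\<^bsub>Q\<^esub> \<pi> h = \<one>\<^bsub>Q\<^esub>" using k hN by (simp add: \<pi>_mult \<pi>_inv)
      then have "\<pi> k = \<pi> h"
        using k hN \<pi>_closed Q.inv_solve_right'[of "\<one>\<^bsub>Q\<^esub>" "\<pi> k" "\<pi> h"] by simp
      with sep h hN show False by blast
    qed
  qed
  also have "\<dots> \<le> enat (card (rcosets N) * order Q ^ card (rcosets N))"
    using index by simp
  finally show ?thesis unfolding depth by (simp add: enat_power)
qed


text \<open>The hypothesis only asks for one good element of \<open>H\<close> in the coset \<open>N g\<close>, so that the
  element can be chosen short; \<open>F\<close> will be a growth function of \<open>N\<close> at a multiple of the length.\<close>

lemma (in group) sep_depth_le_restricted: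
  assumes N: "N \<lhd> G" and fin: "finite (rcosets N)" and H: "subgroup H G"
    and g: "g \<in> carrier G" and F: "1 \<le> F"
    and bound: "\<And>h. h \<in> H \<Longrightarrow> N #> h = N #> g \<Longrightarrow>
      \<exists>h' \<in> H. N #> h' = N #> g \<and> sep_depth (G\<lparr>carrier := N\<rparr>) (N \<inter> H) (g \<otimes> inv h') \<le> F"
  shows "sep_depth G H g \<le> enat (card (rcosets N)) * F ^ ((card (rcosets N))\<^sup>2)"
proof -
  interpret N: normal N G by (rule N)
  let ?d = "card (rcosets N)"
  have HG: "h \<in> carrier G" if "h \<in> H" for h using that subgroup.mem_carrier[OF H] by blast
  show ?thesis
  proof (cases "\<exists>h \<in> H. N #> h = N #> g")
    case True
    then obtain h where h: "h \<in> H" "N #> h = N #> g"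
      and le: "sep_depth (G\<lparr>carrier := N\<rparr>) (N \<inter> H) (g \<otimes> inv h) \<le> F"
      using bound by blast
    have k: "g \<otimes> inv h \<in> N"
      using rcoset_eq_iff[OF N.subgroup_axioms g HG[OF h(1)]] h(2) by simp
    have "sep_depth G H g \<le> sep_depth G H (g \<otimes> inv h)"
      using h(1) by (intro sep_depth_mult_right[OF is_group H g] subgroup.m_inv_closed[OF H])
    also have "\<dots> \<le> enat ?d * sep_depth (G\<lparr>carrier := N\<rparr>) (N \<inter> H) (g \<otimes> inv h) ^ ?d"
      by (rule sep_depth_le_power[OF N fin H k])
    also have "\<dots> \<le> enat ?d * F ^ ?d"
      using le by (intro mult_left_mono power_mono) auto
    also have "\<dots> \<le> enat ?d * F ^ (?d\<^sup>2)"
      using F by (intro mult_left_mono power_increasing) (auto simp: power2_eq_square)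
    finally show ?thesis .
  next
    case False
    have "sep_depth G H g \<le> enat ?d"
      using False rcoset_eq_iff[OF N.subgroup_axioms g HG]
      by (intro sep_depth_le_normal[OF N fin H g]) metis
    also have "\<dots> \<le> enat ?d * F ^ (?d\<^sup>2)"
      using mult_left_mono[OF one_le_power[OF F], of "enat ?d" "?d\<^sup>2"] by simp
    finally show ?thesis .
  qed
qed

section \<open>Finite-index normal subgroups and word length\<close>

text \<open>The Schreier generators for a transversal of words of length at most \<open>[G:N]\<close>. Each is a product
  of two representatives and one letter.\<close>

lemma (in group) finite_index_intersection:
  assumes N: "N \<lhd> G" and fin: "finite (rcosets N)" and X: "X \<subseteq> carrier G" "finite X"
  shows "\<exists>Y. finite Y \<and> Y \<subseteq> N \<inter> generate G X \<and> generate G Y = N \<inter> generate G X \<and>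
    (\<forall>g \<in> N \<inter> generate G X. word_length G Y g \<le> word_length G X g) \<and>
    (\<forall>y \<in> Y. word_length G X y \<le> 2 * card (rcosets N) + 1)"
proof -
  interpret N: normal N G by (rule N)
  let ?Q = "G Mod N" and ?h = "\<lambda>x. N #> x" and ?d = "card (rcosets N)"
  interpret hom: group_hom G ?Q ?h
    using N.factorgroup_is_group N.r_coset_hom_Mod is_group
    by (simp add: group_hom_def group_hom_axioms_def)
  have fin_Q: "finite (carrier ?Q)" and order_Q: "order ?Q = ?d"
    using fin by (simp_all add: order_def FactGroup_def)
  have one_Q: "\<one>\<^bsub>?Q\<^esub> = N" by (simp add: FactGroup_def)
  have kernel: "kernel G ?Q ?h = N"
  proof (rule Set.set_eqI)
    fix x show "x \<in> kernel G ?Q ?h \<longleftrightarrow> x \<in> N"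
      using rcoset_eq_iff[OF N.subgroup_axioms _ one_closed, of x] N.mem_carrier[of x]
      by (cases "x \<in> carrier G") (auto simp add: kernel_def one_Q coset_mult_one N.subset)
  qed
  have "\<exists>x. q \<in> ?h ` generate G X \<longrightarrow>
      x \<in> generate G X \<and> ?h x = q \<and> word_length G X x \<le> ?d" for q
    using hom.short_representative[OF X(1) fin_Q] order_Q by (metis imageE less_imp_le)
  then obtain r0 where r0: "\<And>q. q \<in> ?h ` generate G X \<Longrightarrow>
      r0 q \<in> generate G X \<and> ?h (r0 q) = q \<and> word_length G X (r0 q) \<le> ?d"
    by metis
  \<comment> \<open>Rewriting ends in the representative of the trivial coset, which must be the identity.\<close>
  define r where "r = r0(\<one>\<^bsub>?Q\<^esub> := \<one>)"
  have r: "r q \<in> generate G X \<and> ?h (r q) = q" "word_length G X (r q) \<le> ?d"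
    if "q \<in> ?h ` generate G X" for q
    using r0[OF that] hom.hom_one by (auto simp: r_def generate.one word_length_one)
  have r1: "r \<one>\<^bsub>?Q\<^esub> = \<one>" by (simp add: r_def)
  define Y where "Y = {inv (r (?h (x \<otimes> r q))) \<otimes> (x \<otimes> r q) | x q.
    x \<in> letters X \<and> q \<in> ?h ` generate G X}"
  note Y = hom.schreier[of X r, OF X(1) r(1) r1, folded Y_def]
  have YG: "Y \<subseteq> carrier G" using Y(1) generate_incl[OF X(1)] by blast
  show ?thesis
  proof (intro exI[of _ Y] conjI ballI)
    have "Y = (\<lambda>(x, q). inv (r (?h (x \<otimes> r q))) \<otimes> (x \<otimes> r q)) ` (letters X \<times> ?h ` generate G X)"
      unfolding Y_def by auto
    moreover have "?h ` generate G X \<subseteq> carrier ?Q"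
      using generate_incl[OF X(1)] by auto
    ultimately show "finite Y"
      using X(2) fin_Q by (auto intro: finite_subset)
    show YN: "Y \<subseteq> N \<inter> generate G X" using Y(1,2) kernel by blast
    show len: "word_length G Y g \<le> word_length G X g" if "g \<in> N \<inter> generate G X" for g
      using Y(3)[of g] that kernel by (auto simp: kernel_def)
    show "generate G Y = N \<inter> generate G X"
    proof
      show "generate G Y \<subseteq> N \<inter> generate G X"
        using YN by (intro generate_subgroup_incl subgroups_Inter_pair N.subgroup_axioms generate_is_subgroup X)
      show "N \<inter> generate G X \<subseteq> generate G Y"
        using Y(3) kernel by (auto simp: kernel_def)
    qed
    fix y assume "y \<in> Y"
    then obtain x q where xq: "x \<in> letters X" "q \<in> ?h ` generate G X"
      and y: "y = inv (r (?h (x \<otimes> r q))) \<otimes> (x \<otimes> r q)" unfolding Y_def by blast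
    have x: "x \<in> generate G X" using xq letters_subset_generate by blast
    have xr: "x \<otimes> r q \<in> generate G X" using x r(1)[OF xq(2)] by (auto intro: generate.eng)
    note r' = r[OF imageI[OF xr]]
    have "word_length G X y \<le> word_length G X (inv (r (?h (x \<otimes> r q)))) + word_length G X (x \<otimes> r q)"
      unfolding y using r' xr by (intro word_length_mult generate_m_inv_closed X) auto
    also have "word_length G X (inv (r (?h (x \<otimes> r q)))) \<le> ?d"
      using r' word_length_inv[OF X(1), of "r (?h (x \<otimes> r q))"] by linarith
    also have "word_length G X (x \<otimes> r q) \<le> 1 + ?d"
      using word_length_mult[OF X(1) x, of "r q"] word_length_letter[OF X(1) xq(1)] r[OF xq(2)] by linarith
    finally show "word_length G X y \<le> 2 * ?d + 1" by simp
  qed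
qed

lemma (in group) ex_short_coset_representative:
  assumes N: "N \<lhd> G" and fin: "finite (rcosets N)" and X: "X \<subseteq> carrier G" and h: "h \<in> generate G X"
  shows "\<exists>h' \<in> generate G X. N #> h' = N #> h \<and> word_length G X h' \<le> card (rcosets N)"
proof -
  interpret N: normal N G by (rule N)
  interpret hom: group_hom G "G Mod N" "\<lambda>x. N #> x"
    using N.factorgroup_is_group N.r_coset_hom_Mod is_group
    by (simp add: group_hom_def group_hom_axioms_def)
  have "finite (carrier (G Mod N))" "order (G Mod N) = card (rcosets N)"
    using fin by (simp_all add: order_def FactGroup_def)
  then show ?thesis
    using hom.short_representative[OF X _ h] by (metis less_imp_le)
qed

lemma (in group) uniform_word_length_bound:
  assumes S: "S \<subseteq> carrier G" and X: "finite X" "X \<subseteq> generate G S"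
  shows "\<exists>C \<ge> 1. \<forall>g \<in> generate G X. word_length G S g \<le> C * word_length G X g"
proof (intro exI[of _ "Max (insert 1 (word_length G S ` X))"] conjI ballI)
  show "1 \<le> Max (insert 1 (word_length G S ` X))" using X(1) by simp
  show "word_length G S g \<le> Max (insert 1 (word_length G S ` X)) * word_length G X g"
    if "g \<in> generate G X" for g
    using X(1) by (intro word_length_change_generators[OF S X(2) Max_ge that]) auto
qed

text \<open>Schreier rewriting from \<open>S\<close> to generators of \<open>N\<close> does not lengthen words, and passing from
  those to \<open>S'\<close> costs a constant factor.\<close>

lemma (in group) finite_index_undistorted:
  assumes N: "N \<lhd> G" and fin: "finite (rcosets N)" and S: "S \<subseteq> carrier G" "finite S" "generate G S = carrier G"
    and S': "S' \<subseteq> carrier G" "generate G S' = N"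
  shows "\<exists>C \<ge> 1. \<forall>g \<in> N. word_length G S' g \<le> C * word_length G S g"
proof -
  have NG: "N \<inter> carrier G = N"
    using subgroup.subset[OF normal_imp_subgroup[OF N]] by blast
  obtain Y where Y: "finite Y" "Y \<subseteq> N" "generate G Y = N"
    "\<forall>g \<in> N. word_length G Y g \<le> word_length G S g"
    using finite_index_intersection[OF N fin S(1,2)] unfolding S(3) NG by blast
  obtain C where C: "1 \<le> C" "\<forall>g \<in> N. word_length G S' g \<le> C * word_length G Y g"
    using uniform_word_length_bound[OF S'(1) Y(1)] Y(2,3) unfolding S'(2) by blast
  have "word_length G S' g \<le> C * word_length G S g" if "g \<in> N" for g
    by (rule order_trans[OF C(2)[rule_format, OF that] mult_le_mono2[OF Y(4)[rule_format, OF that]]])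
  with C(1) show ?thesis by blast
qed

section \<open>Growth functions\<close>

lemma (in group) ex_generator_outside:
  assumes "finite_gen_set G S" "subgroup H G" "H \<noteq> carrier G"
  shows "\<exists>s \<in> S. s \<in> carrier G - H \<and> word_length G S s \<le> 1"
proof -
  have S: "S \<subseteq> carrier G" "generate G S = carrier G"
    using assms(1) by (auto simp: finite_gen_set_def)
  have "\<not> S \<subseteq> H"
    using generate_subgroup_incl[OF _ assms(2)] S assms(2,3) subgroup.subset by blast
  then obtain s where "s \<in> S" "s \<notin> H" by blast
  with S word_length_letter[OF S(1), of s] show ?thesis by blast
qed

context group
begin

context
  fixes S assumes gen: "finite_gen_set G S"
begin

lemma finite_ball: "finite {g \<in> carrier G. word_length G S g \<le> n}"
  using finite_word_ball[of S n] gen by (simp add: finite_gen_set_def)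

lemma finite_F_growth_set:
  "finite {sep_depth G H g | g. g \<in> carrier G - H \<and> word_length G S g \<le> n}"
  by (rule finite_subset[OF _ finite_imageI[OF finite_ball[of n], of "sep_depth G H"]]) auto

lemma F_growth_ge:
  "g \<in> carrier G - H \<Longrightarrow> word_length G S g \<le> n \<Longrightarrow> sep_depth G H g \<le> F_growth G H S n"
  unfolding F_growth_def by (rule Max_ge[OF finite_F_growth_set]) blast

lemma F_growth_le:
  assumes "subgroup H G" "H \<noteq> carrier G" "n \<ge> 1"
    and "\<And>g. g \<in> carrier G - H \<Longrightarrow> word_length G S g \<le> n \<Longrightarrow> sep_depth G H g \<le> c"
  shows "F_growth G H S n \<le> c"
  unfolding F_growth_def
proof (subst Max_le_iff[OF finite_F_growth_set])
  show "{sep_depth G H g | g. g \<in> carrier G - H \<and> word_length G S g \<le> n} \<noteq> {}"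
  proof -
    obtain s where "s \<in> carrier G - H" "word_length G S s \<le> 1"
      using ex_generator_outside[OF gen assms(1,2)] by blast
    moreover from this have "word_length G S s \<le> n" using assms(3) by linarith
    ultimately show ?thesis by blast
  qed
qed (use assms(4) in blast)

lemma F_growth_ge_1:
  assumes "subgroup H G" "H \<noteq> carrier G" "n \<ge> 1"
  shows "1 \<le> F_growth G H S n"
proof -
  obtain s where "s \<in> carrier G - H" "word_length G S s \<le> 1"
    using ex_generator_outside[OF gen assms(1,2)] by blast
  then have "sep_depth G H s \<le> F_growth G H S n"
    using assms(3) by (intro F_growth_ge) auto
  then show ?thesis using sep_depth_ge_1[of G H s] by (rule order_trans[rotated])
qed

lemma short_generating_set:
  assumes "fg_subgroup G H"
  shows "\<exists>X. finite X \<and> X \<subseteq> H \<and> generate G X = H \<and>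
    (\<forall>x \<in> X. word_length G S x \<le> subgroup_length G S H)"
proof -
  have "\<exists>m X. finite X \<and> X \<subseteq> H \<and> generate G X = H \<and> set_length G S X = m"
    using assms by (auto simp: fg_subgroup_def)
  from LeastI_ex[OF this] obtain X where X: "finite X" "X \<subseteq> H" "generate G X = H"
    "set_length G S X = subgroup_length G S H"
    unfolding subgroup_length_def by blast
  have "word_length G S x \<le> subgroup_length G S H" if "x \<in> X" for x
    unfolding X(4)[symmetric] set_length_def using X(1) that by (intro Max_ge) simp_all
  with X(1,2,3) show ?thesis by blast
qed

lemma finite_Sub_growth_set:
  "finite {sep_depth G H g | H g. fg_subgroup G H \<and> g \<in> carrier G - H \<and>
     subgroup_length G S H \<le> n \<and> word_length G S g \<le> n}" (is "finite ?A")
proof (rule finite_subset)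
  let ?B = "{g \<in> carrier G. word_length G S g \<le> n}"
  show "finite ((\<lambda>(X, g). sep_depth G (generate G X) g) ` (Pow ?B \<times> ?B))"
    by (intro finite_imageI finite_cartesian_product finite_Pow_iff[THEN iffD2] finite_ball)
  show "?A \<subseteq> (\<lambda>(X, g). sep_depth G (generate G X) g) ` (Pow ?B \<times> ?B)"
  proof
    fix q assume "q \<in> ?A"
    then obtain H g where q: "q = sep_depth G H g" and *: "fg_subgroup G H" "g \<in> carrier G" "g \<notin> H"
      "subgroup_length G S H \<le> n" "word_length G S g \<le> n" by blast
    obtain X where X: "finite X" "X \<subseteq> H" "generate G X = H"
      "\<forall>x \<in> X. word_length G S x \<le> subgroup_length G S H"
      using short_generating_set[OF *(1)] by (elim exE conjE) (rule that)
    have "H \<subseteq> carrier G" using *(1) by (simp add: fg_subgroup_def subgroup.subset)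
    have "x \<in> ?B" if "x \<in> X" for x
      using that X(2) \<open>H \<subseteq> carrier G\<close> order_trans[OF X(4)[rule_format] *(4)] by (simp add: subset_iff)
    then have "(X, g) \<in> Pow ?B \<times> ?B" using *(2,5) by simp blast
    moreover have "q = (\<lambda>(X, g). sep_depth G (generate G X) g) (X, g)" by (simp add: q X(3))
    ultimately show "q \<in> (\<lambda>(X, g). sep_depth G (generate G X) g) ` (Pow ?B \<times> ?B)"
      by (rule rev_image_eqI)
  qed
qed

lemma Sub_growth_ge:
  "fg_subgroup G H \<Longrightarrow> g \<in> carrier G - H \<Longrightarrow> subgroup_length G S H \<le> n \<Longrightarrow>
    word_length G S g \<le> n \<Longrightarrow> sep_depth G H g \<le> Sub_growth G S n"
  unfolding Sub_growth_def by (rule Max_ge[OF finite_Sub_growth_set]) blast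

end

lemma subgroup_length_le:
  assumes "finite X" "\<And>x. x \<in> X \<Longrightarrow> word_length G S x \<le> n"
  shows "subgroup_length G S (generate G X) \<le> n"
proof -
  have "subgroup_length G S (generate G X) \<le> set_length G S X"
    unfolding subgroup_length_def using assms(1)
    by (intro Least_le exI[of _ X]) (simp add: generate.incl subsetI)
  also have "\<dots> \<le> n" using assms by (simp add: set_length_def)
  finally show ?thesis .
qed

lemma trivial_fg_subgroup: "fg_subgroup G {\<one>}" "subgroup_length G S {\<one>} = 0"
proof -
  show "fg_subgroup G {\<one>}"
    unfolding fg_subgroup_def using triv_subgroup
    by (intro conjI exI[of _ "{}"]) (simp_all add: generate_empty)
  show "subgroup_length G S {\<one>} = 0"
    using subgroup_length_le[of "{}" S 0] by (simp add: generate_empty)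
qed

lemma ex_Sub_growth_element:
  assumes "finite_gen_set G S" "carrier G \<noteq> {\<one>}" "n \<ge> 1"
  obtains g where "g \<in> carrier G - {\<one>}" "subgroup_length G S {\<one>} \<le> n" "word_length G S g \<le> n"
proof -
  obtain s where "s \<in> carrier G - {\<one>}" "word_length G S s \<le> 1"
    using ex_generator_outside[OF assms(1) triv_subgroup] assms(2) by blast
  then show thesis using that[of s] assms(3) trivial_fg_subgroup(2)[of S] by simp
qed

lemma Sub_growth_le:
  assumes "finite_gen_set G S" "carrier G \<noteq> {\<one>}" "n \<ge> 1"
    and "\<And>H g. fg_subgroup G H \<Longrightarrow> g \<in> carrier G - H \<Longrightarrow> subgroup_length G S H \<le> n \<Longrightarrow>
      word_length G S g \<le> n \<Longrightarrow> sep_depth G H g \<le> c"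
  shows "Sub_growth G S n \<le> c"
  unfolding Sub_growth_def
proof (subst Max_le_iff[OF finite_Sub_growth_set[OF assms(1)]])
  show "{sep_depth G H g | H g. fg_subgroup G H \<and> g \<in> carrier G - H \<and>
     subgroup_length G S H \<le> n \<and> word_length G S g \<le> n} \<noteq> {}"
  proof -
    obtain g where "g \<in> carrier G - {\<one>}" "subgroup_length G S {\<one>} \<le> n" "word_length G S g \<le> n"
      using ex_Sub_growth_element[OF assms(1-3)] .
    with trivial_fg_subgroup(1) show ?thesis by blast
  qed
qed (use assms(4) in blast)

lemma Sub_growth_ge_1:
  assumes "finite_gen_set G S" "carrier G \<noteq> {\<one>}" "n \<ge> 1"
  shows "1 \<le> Sub_growth G S n"
proof -
  obtain g where "g \<in> carrier G - {\<one>}" "subgroup_length G S {\<one>} \<le> n" "word_length G S g \<le> n"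
    using ex_Sub_growth_element[OF assms] .
  then have "sep_depth G {\<one>} g \<le> Sub_growth G S n"
    by (rule Sub_growth_ge[OF assms(1) trivial_fg_subgroup(1)])
  then show ?thesis using sep_depth_ge_1[of G "{\<one>}" g] by (rule order_trans[rotated])
qed

end

section \<open>Passing between the group and a subgroup\<close>

context group
begin

context
  fixes N assumes N: "subgroup N G"
begin

lemma word_length_subgroup:
  assumes "S \<subseteq> N"
  shows "word_length (G\<lparr>carrier := N\<rparr>) S = word_length G S"
proof -
  have "m_inv (G\<lparr>carrier := N\<rparr>) ` S = m_inv G ` S"
    using assms m_inv_consistent[OF N] by (intro image_cong) auto
  then show ?thesis by (simp add: word_length_def fun_eq_iff)
qed

lemma generate_subgroup: "X \<subseteq> N \<Longrightarrow> generate (G\<lparr>carrier := N\<rparr>) X = generate G X"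
  using generate_consistent[OF _ N] by simp

lemma finite_gen_set_subgroup:
  "finite_gen_set (G\<lparr>carrier := N\<rparr>) S \<longleftrightarrow> finite S \<and> S \<subseteq> N \<and> generate G S = N"
  using generate_subgroup by (auto simp: finite_gen_set_def)

lemma fg_subgroup_subgroup:
  "fg_subgroup (G\<lparr>carrier := N\<rparr>) K \<longleftrightarrow> fg_subgroup G K \<and> K \<subseteq> N"
proof -
  have "subgroup K (G\<lparr>carrier := N\<rparr>) \<longleftrightarrow> subgroup K G \<and> K \<subseteq> N"
  proof
    assume K: "subgroup K (G\<lparr>carrier := N\<rparr>)"
    show "subgroup K G \<and> K \<subseteq> N"
      using incl_subgroup[OF N K] subgroup.subset[OF K] by simp
  qed (use subgroup_incl[OF _ N] in blast)
  moreover have "X \<subseteq> K \<and> generate (G\<lparr>carrier := N\<rparr>) X = K \<longleftrightarrow> X \<subseteq> K \<and> generate G X = K"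
    if "K \<subseteq> N" for X
    using generate_subgroup[OF order_trans[OF _ that]] by (simp cong: conj_cong)
  ultimately show ?thesis
    unfolding fg_subgroup_def by (cases "K \<subseteq> N") simp_all
qed

end

text \<open>Applied in contrapositive form: a subgroup of infinite index does not contain \<open>N\<close>, so
  \<open>N \<inter> H\<close> is a proper subgroup of \<open>N\<close> and the growth functions are maxima over nonempty sets.\<close>

lemma finite_rcosets_supergroup:
  assumes N: "subgroup N G" "finite (rcosets N)" and H: "subgroup H G" "N \<subseteq> H"
  shows "finite (rcosets H)"
  unfolding rcosets_eq_image[of H]
proof (rule finite_card_image_factor(1))
  show "finite ((\<lambda>x. N #> x) ` carrier G)" using N(2) by (simp add: rcosets_eq_image)
  show "H #> x = H #> y" if "x \<in> carrier G" "y \<in> carrier G" "N #> x = N #> y" for x y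
    using rcoset_eq_iff[OF N(1) that(1,2)] rcoset_eq_iff[OF H(1) that(1,2)] that(3) H(2) by blast
qed

end

section \<open>Growth functions of a finite-index normal subgroup\<close>

lemma enat_le_mult:
  assumes "1 \<le> C" shows "(a :: enat) \<le> enat C * a"
proof -
  have "1 \<le> enat C" using assms by (simp add: one_enat_def)
  from mult_right_mono[OF this, of a] show ?thesis by (simp only: mult_1 zero_le simp_thms)
qed

locale finite_index_normal = N?: normal N G for N and G (structure) +
  fixes S S'
  assumes finite_index: "finite (rcosets N)"
    and S: "finite_gen_set G S"
    and S': "finite_gen_set (G\<lparr>carrier := N\<rparr>) S'"
begin

abbreviation "GN \<equiv> G\<lparr>carrier := N\<rparr>"

abbreviation "d \<equiv> card (rcosets N)"

lemma index_pos: "1 \<le> d"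
proof -
  have "rcosets N \<noteq> {}" unfolding rcosets_eq_image using one_closed by blast
  then have "0 < d" using finite_index by (simp add: card_gt_0_iff)
  then show ?thesis by simp
qed

lemma gens: "finite S" "S \<subseteq> carrier G" "generate G S = carrier G"
    "finite S'" "S' \<subseteq> N" "S' \<subseteq> carrier G" "generate G S' = N"
proof -
  show "finite S" "S \<subseteq> carrier G" "generate G S = carrier G"
    using S by (simp_all only: finite_gen_set_def)
  show "finite S'" "S' \<subseteq> N" "generate G S' = N"
    using S' by (simp_all only: finite_gen_set_subgroup[OF subgroup_axioms])
  from this(2) subset show "S' \<subseteq> carrier G" by (rule order_trans)
qed

lemma group_GN: "group GN"
  by (rule subgroup_is_group[OF is_group])

lemma subgroup_Int_GN: "subgroup H G \<Longrightarrow> subgroup (N \<inter> H) GN"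
  by (rule subgroup_incl[OF subgroups_Inter_pair[OF subgroup_axioms] subgroup_axioms Int_lower1])

lemma word_length_GN: "word_length GN S' = word_length G S'"
  by (rule word_length_subgroup[OF subgroup_axioms gens(5)])

lemma word_length_le_word_length_N:
  "\<exists>C \<ge> 1. \<forall>g \<in> N. word_length G S g \<le> C * word_length GN S' g"
  using uniform_word_length_bound[of S S', OF gens(2,4)] gens(3,6)
  by (simp add: word_length_GN gens(7))

lemma word_length_N_le_word_length:
  "\<exists>C \<ge> 1. \<forall>g \<in> N. word_length GN S' g \<le> C * word_length G S g"
  unfolding word_length_GN
  by (rule finite_index_undistorted[OF normal_axioms finite_index gens(2,1,3,6,7)])

lemma F_growth_N_le:
  assumes H: "subgroup H G" "\<not> N \<subseteq> H"
  shows "F_growth GN (N \<inter> H) S' \<preceq> F_growth G H S"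
proof -
  interpret GN: group GN by (rule group_GN)
  obtain C where C: "1 \<le> C" "\<forall>g \<in> N. word_length G S g \<le> C * word_length GN S' g"
    using word_length_le_word_length_N by blast
  show ?thesis
    unfolding growth_le_def
  proof (intro exI[of _ C] conjI allI impI C(1))
    fix n :: nat assume n: "1 \<le> n"
    have "F_growth GN (N \<inter> H) S' n \<le> F_growth G H S (C * n)"
    proof (rule GN.F_growth_le[OF S' _ _ n])
      show "subgroup (N \<inter> H) GN" by (rule subgroup_Int_GN[OF H(1)])
      show "N \<inter> H \<noteq> carrier GN" using H(2) by auto
      fix g assume g: "g \<in> carrier GN - N \<inter> H" "word_length GN S' g \<le> n"
      then have "word_length G S g \<le> C * n"
        using order_trans[OF C(2)[rule_format] mult_le_mono2, of g n] by simp
      moreover have "g \<in> carrier G - H" using g(1) subset by auto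
      ultimately have "sep_depth G H g \<le> F_growth G H S (C * n)"
        by (intro F_growth_ge[OF S])
      then show "sep_depth GN (N \<inter> H) g \<le> F_growth G H S (C * n)"
        by (rule order_trans[OF sep_depth_restrict[OF subset Int_lower2]])
    qed
    also have "\<dots> \<le> enat C * F_growth G H S (C * n)" by (rule enat_le_mult[OF C(1)])
    finally show "F_growth GN (N \<inter> H) S' n \<le> enat C * F_growth G H S (C * n)" .
  qed
qed

text \<open>Each of the finitely many cosets of \<open>N\<close> that meet \<open>H\<close> has a fixed representative in \<open>H\<close>, so an element of \<open>N H\<close> is
  carried into \<open>N\<close> by an element of \<open>H\<close> of bounded length.\<close>

lemma F_growth_le_power:
  assumes H: "subgroup H G" "\<not> N \<subseteq> H"
  shows "F_growth G H S \<preceq> (\<lambda>n. F_growth GN (N \<inter> H) S' n ^ (d\<^sup>2))"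
proof -
  interpret GN: group GN by (rule group_GN)
  obtain C where C: "1 \<le> C" "\<forall>g \<in> N. word_length GN S' g \<le> C * word_length G S g"
    using word_length_N_le_word_length by blast
  have HG: "h \<in> carrier G" if "h \<in> H" for h using that subgroup.mem_carrier[OF H(1)] by blast
  have "\<forall>c \<in> (\<lambda>h. N #> h) ` H. \<exists>h. h \<in> H \<and> N #> h = c" by auto
  from bchoice[OF this] obtain r where "\<forall>c \<in> (\<lambda>h. N #> h) ` H. r c \<in> H \<and> N #> r c = c" ..
  then have r: "r (N #> h) \<in> H \<and> N #> r (N #> h) = N #> h" if "h \<in> H" for h
    using that by blast
  have fin: "finite ((\<lambda>h. N #> h) ` H)"
    using HG by (intro finite_subset[OF _ finite_index]) (auto simp: rcosets_eq_image)
  define L where "L = Max (insert 0 ((\<lambda>c. word_length G S (r c)) ` (\<lambda>h. N #> h) ` H))"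
  have L: "word_length G S (r (N #> h)) \<le> L" if "h \<in> H" for h
    unfolding L_def using fin that by (intro Max_ge) auto
  \<comment> \<open>One constant serves as the factor \<open>d\<close> and as the length factor \<open>C (1 + L)\<close>, for \<open>n + L\<close> is at
    most \<open>(1 + L) n\<close>.\<close>
  define K where "K = d * (C * (1 + L))"
  have K: "1 \<le> K" "d \<le> K" "C * (1 + L) \<le> K"
    unfolding K_def using index_pos C(1) by auto
  have properN: "subgroup (N \<inter> H) GN" "N \<inter> H \<noteq> carrier GN"
    using subgroup_Int_GN[OF H(1)] H(2) by auto
  show ?thesis
    unfolding growth_le_def
  proof (intro exI[of _ K] conjI allI impI K(1))
    fix n :: nat assume n: "1 \<le> n"
    let ?F = "F_growth GN (N \<inter> H) S' (K * n)"
    have F1: "1 \<le> ?F" using K(1) n by (intro GN.F_growth_ge_1[OF S' properN]) simp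
    have "F_growth G H S n \<le> enat d * ?F ^ (d\<^sup>2)"
    proof (rule F_growth_le[OF S H(1) _ n])
      show "H \<noteq> carrier G" using H(2) subset by blast
      fix g assume g: "g \<in> carrier G - H" "word_length G S g \<le> n"
      show "sep_depth G H g \<le> enat d * ?F ^ (d\<^sup>2)"
      proof (rule sep_depth_le_restricted[OF normal_axioms finite_index H(1) _ F1])
        show gG: "g \<in> carrier G" using g by blast
        fix h assume h: "h \<in> H" "N #> h = N #> g"
        define k where "k = g \<otimes> inv (r (N #> h))"
        have rH: "r (N #> h) \<in> H" "N #> r (N #> h) = N #> g"
          using r[OF h(1)] h(2) by simp_all
        have kN: "k \<in> N"
          unfolding k_def using rcoset_eq_iff[OF subgroup_axioms gG HG[OF rH(1)]] rH(2) by simp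
        have "k \<notin> H"
        proof
          assume "k \<in> H"
          then have "k \<otimes> r (N #> h) \<in> H" using rH(1) by (intro subgroup.m_closed[OF H(1)])
          then show False using g gG HG[OF rH(1)] by (simp add: k_def m_assoc)
        qed
        have "word_length G S k \<le> word_length G S g + word_length G S (inv (r (N #> h)))"
          unfolding k_def using gG HG[OF rH(1)] gens by (intro word_length_mult) auto
        also have "word_length G S (inv (r (N #> h))) \<le> L"
          using word_length_inv[of S "r (N #> h)"] gens HG[OF rH(1)] L[OF h(1)] by auto
        finally have "word_length G S k \<le> n + L" using g(2) by simp
        also have "\<dots> \<le> (1 + L) * n" using n by (cases n) auto
        finally have "word_length GN S' k \<le> C * ((1 + L) * n)"
          by (intro order_trans[OF C(2)[rule_format, OF kN] mult_le_mono2])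
        also have "\<dots> \<le> K * n" using mult_le_mono1[OF K(3), of n] by (simp only: mult.assoc)
        finally have "sep_depth GN (N \<inter> H) k \<le> ?F"
          using kN \<open>k \<notin> H\<close> by (intro GN.F_growth_ge[OF S']) auto
        then show "\<exists>h' \<in> H. N #> h' = N #> g \<and> sep_depth GN (N \<inter> H) (g \<otimes> inv h') \<le> ?F"
          using rH unfolding k_def by blast
      qed
    qed
    also have "\<dots> \<le> enat K * ?F ^ (d\<^sup>2)" using K(2) by (intro mult_right_mono) auto
    finally show "F_growth G H S n \<le> enat K * ?F ^ (d\<^sup>2)" .
  qed
qed

lemma Sub_growth_N_le:
  assumes "N \<noteq> {\<one>}"
  shows "Sub_growth GN S' \<preceq> Sub_growth G S"
proof -
  interpret GN: group GN by (rule group_GN)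
  obtain C where C: "1 \<le> C" "\<forall>g \<in> N. word_length G S g \<le> C * word_length GN S' g"
    using word_length_le_word_length_N by blast
  show ?thesis
    unfolding growth_le_def
  proof (intro exI[of _ C] conjI allI impI C(1))
    fix n :: nat assume n: "1 \<le> n"
    have "Sub_growth GN S' n \<le> Sub_growth G S (C * n)"
    proof (rule GN.Sub_growth_le[OF S' _ n])
      show "carrier GN \<noteq> {\<one>\<^bsub>GN\<^esub>}" using assms by simp
      fix K g assume K: "fg_subgroup GN K" and g: "g \<in> carrier GN - K" "word_length GN S' g \<le> n"
        and len: "subgroup_length GN S' K \<le> n"
      have KG: "fg_subgroup G K" "K \<subseteq> N" using K fg_subgroup_subgroup[OF subgroup_axioms] by auto
      obtain X where X: "finite X" "X \<subseteq> K" "generate GN X = K"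
        "\<forall>x \<in> X. word_length GN S' x \<le> subgroup_length GN S' K"
        using GN.short_generating_set[OF S' K] by (elim exE conjE) (rule that)
      have XK: "generate G X = K" using X KG generate_subgroup[OF subgroup_axioms, of X] by auto
      have bound: "word_length G S x \<le> C * n" if "x \<in> N" "word_length GN S' x \<le> n" for x
        using C(2)[rule_format, OF that(1)] mult_le_mono2[OF that(2), of C] by linarith
      have "subgroup_length G S K \<le> C * n"
        unfolding XK[symmetric] using X(1,2) KG(2) order_trans[OF X(4)[rule_format] len]
        by (intro subgroup_length_le bound) (simp_all add: subset_iff)
      moreover have "word_length G S g \<le> C * n" using g by (intro bound) simp_all
      ultimately have "sep_depth G K g \<le> Sub_growth G S (C * n)"
        using g subset by (intro Sub_growth_ge[OF S KG(1)]) (auto simp: subset_iff)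
      then show "sep_depth GN K g \<le> Sub_growth G S (C * n)"
        by (rule order_trans[OF sep_depth_restrict[OF subset order_refl]])
    qed
    also have "\<dots> \<le> enat C * Sub_growth G S (C * n)" by (rule enat_le_mult[OF C(1)])
    finally show "Sub_growth GN S' n \<le> enat C * Sub_growth G S (C * n)" .
  qed
qed

text \<open>The constant must not depend on \<open>H\<close>, so representatives of the cosets of \<open>N\<close> that meet \<open>H\<close> are
  taken as words in short generators of \<open>H\<close>; their lengths and those of the Schreier generators of
  \<open>N \<inter> H\<close> are then linear in \<open>n\<close>, with coefficients that depend on the index of \<open>N\<close> only.\<close>

lemma Sub_growth_le_power:
  assumes "N \<noteq> {\<one>}"
  shows "Sub_growth G S \<preceq> (\<lambda>n. Sub_growth GN S' n ^ (d\<^sup>2))"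
proof -
  interpret GN: group GN by (rule group_GN)
  obtain C where C: "1 \<le> C" "\<forall>g \<in> N. word_length GN S' g \<le> C * word_length G S g"
    using word_length_N_le_word_length by blast
  \<comment> \<open>Schreier generators of \<open>N \<inter> H\<close> have length at most \<open>(2 d + 1) n\<close> in \<open>S\<close>, and the translated
    element of \<open>N\<close> at most \<open>(d + 1) n\<close>.\<close>
  define K where "K = C * (2 * d + 1)"
  have K: "1 \<le> K" "d \<le> K" "C * (2 * d + 1) \<le> K" "C * (d + 1) \<le> K"
  proof -
    have "2 * d + 1 \<le> K" unfolding K_def using C(1) mult_right_mono[of 1 C "2 * d + 1"] by simp
    then show "1 \<le> K" "d \<le> K" by linarith+
    show "C * (d + 1) \<le> K" unfolding K_def by (intro mult_le_mono2) simp
  qed (simp add: K_def)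
  have properN: "carrier GN \<noteq> {\<one>\<^bsub>GN\<^esub>}" using assms by simp
  show ?thesis
    unfolding growth_le_def
  proof (intro exI[of _ K] conjI allI impI K(1))
    fix n :: nat assume n: "1 \<le> n"
    let ?F = "Sub_growth GN S' (K * n)"
    have F1: "1 \<le> ?F" using K(1) n by (intro GN.Sub_growth_ge_1[OF S' properN]) simp
    have "Sub_growth G S n \<le> enat d * ?F ^ (d\<^sup>2)"
    proof (rule Sub_growth_le[OF S _ n])
      show "carrier G \<noteq> {\<one>}"
      proof
        assume "carrier G = {\<one>}"
        then have "N \<subseteq> {\<one>}" using subset by simp
        then show False using assms subgroup.one_closed[OF subgroup_axioms] by auto
      qed
      fix H g assume H: "fg_subgroup G H" and g: "g \<in> carrier G - H" "word_length G S g \<le> n"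
        and len: "subgroup_length G S H \<le> n"
      have sub: "subgroup H G" using H by (simp add: fg_subgroup_def)
      have HG: "H \<subseteq> carrier G" using sub by (rule subgroup.subset)
      obtain X where X: "finite X" "X \<subseteq> H" "generate G X = H"
        "\<forall>x \<in> X. word_length G S x \<le> subgroup_length G S H"
        using short_generating_set[OF S H] by (elim exE conjE) (rule that)
      have XG: "X \<subseteq> carrier G" using X HG by blast
      have stretch: "word_length G S h \<le> n * word_length G X h" if "h \<in> H" for h
        using that XG gens(2,3) X(3) order_trans[OF X(4)[rule_format] len] by (intro word_length_change_generators) simp_all
      obtain Y where Y: "finite Y" "Y \<subseteq> N \<inter> H" "generate G Y = N \<inter> H"
        "\<forall>y \<in> Y. word_length G X y \<le> 2 * d + 1"
        using finite_index_intersection[OF normal_axioms finite_index XG X(1)] unfolding X(3) by metis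
      have "word_length GN S' y \<le> K * n" if "y \<in> Y" for y
      proof -
        have y: "y \<in> N" "y \<in> H" using that Y by auto
        have "word_length GN S' y \<le> C * (n * (2 * d + 1))"
          by (rule order_trans[OF C(2)[rule_format, OF y(1)] mult_le_mono2[OF
              order_trans[OF stretch[OF y(2)] mult_le_mono2[OF Y(4)[rule_format, OF that]]]]])
        also have "\<dots> = C * (2 * d + 1) * n" by (simp only: ac_simps)
        also have "\<dots> \<le> K * n" by (rule mult_le_mono1[OF K(3)])
        finally show ?thesis .
      qed
      then have "subgroup_length GN S' (generate GN Y) \<le> K * n"
        using Y(1) by (intro GN.subgroup_length_le)
      then have lenN: "subgroup_length GN S' (N \<inter> H) \<le> K * n"
        using Y generate_subgroup[OF subgroup_axioms, of Y] by simp
      have fgN: "fg_subgroup GN (N \<inter> H)"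
        unfolding fg_subgroup_subgroup[OF subgroup_axioms] unfolding fg_subgroup_def
        using Y sub by (auto intro: subgroups_Inter_pair subgroup_axioms)
      show "sep_depth G H g \<le> enat d * ?F ^ (d\<^sup>2)"
      proof (rule sep_depth_le_restricted[OF normal_axioms finite_index sub _ F1])
        show gG: "g \<in> carrier G" using g by blast
        fix h assume h: "h \<in> H" "N #> h = N #> g"
        obtain h' where h': "h' \<in> H" "N #> h' = N #> g" "word_length G X h' \<le> d"
          using ex_short_coset_representative[OF normal_axioms finite_index XG, of h] h unfolding X(3) by auto
        have h'G: "h' \<in> carrier G" using h' HG by blast
        define k where "k = g \<otimes> inv h'"
        have kN: "k \<in> N"
          unfolding k_def using rcoset_eq_iff[OF subgroup_axioms gG h'G] h'(2) by simp
        have "k \<notin> H"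
        proof
          assume "k \<in> H"
          then have "k \<otimes> h' \<in> H" using h'(1) by (intro subgroup.m_closed[OF sub])
          then show False using g gG h'G by (simp add: k_def m_assoc)
        qed
        have "word_length G S k \<le> word_length G S g + word_length G S (inv h')"
          unfolding k_def using gG h'G gens by (intro word_length_mult) auto
        moreover have "word_length G S (inv h') \<le> word_length G S h'"
          using gens h'G by (intro word_length_inv) auto
        moreover have "word_length G S h' \<le> n * d"
          by (rule order_trans[OF stretch[OF h'(1)] mult_le_mono2[OF h'(3)]])
        ultimately have "word_length G S k \<le> (d + 1) * n" using g(2) by (simp add: ac_simps)
        then have "word_length GN S' k \<le> C * ((d + 1) * n)"
          by (intro order_trans[OF C(2)[rule_format, OF kN] mult_le_mono2])
        also have "\<dots> \<le> K * n" using mult_le_mono1[OF K(4), of n] by (simp only: mult.assoc)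
        finally have "sep_depth GN (N \<inter> H) k \<le> ?F"
          using kN \<open>k \<notin> H\<close> by (intro GN.Sub_growth_ge[OF S' fgN _ lenN]) auto
        then show "\<exists>h' \<in> H. N #> h' = N #> g \<and> sep_depth GN (N \<inter> H) (g \<otimes> inv h') \<le> ?F"
          using h' unfolding k_def by blast
      qed
    qed
    also have "\<dots> \<le> enat K * ?F ^ (d\<^sup>2)" using K(2) by (intro mult_right_mono) auto
    finally show "Sub_growth G S n \<le> enat K * ?F ^ (d\<^sup>2)" .
  qed
qed

end

theorem theorem5p1:
  fixes G :: "('a, 'b) monoid_scheme" and N S S' :: "'a set"
  assumes "group G"
    and "finite_gen_set G S"
    and "N \<lhd> G"
    and "finite (rcosets\<^bsub>G\<^esub> N)"
    and "finite_gen_set (G\<lparr>carrier := N\<rparr>) S'"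
  shows "(\<forall>H. fg_subgroup G H \<longrightarrow> separable_subgroup G H \<longrightarrow> infinite (rcosets\<^bsub>G\<^esub> H) \<longrightarrow>
            F_growth (G\<lparr>carrier := N\<rparr>) (N \<inter> H) S' \<preceq> F_growth G H S \<and>
            F_growth G H S \<preceq>
              (\<lambda>n. F_growth (G\<lparr>carrier := N\<rparr>) (N \<inter> H) S' n ^ ((card (rcosets\<^bsub>G\<^esub> N))\<^sup>2)))
       \<and> (subgroup_separable G \<and> N \<noteq> {\<one>\<^bsub>G\<^esub>} \<longrightarrow>
            Sub_growth (G\<lparr>carrier := N\<rparr>) S' \<preceq> Sub_growth G S \<and>
            Sub_growth G S \<preceq>
              (\<lambda>n. Sub_growth (G\<lparr>carrier := N\<rparr>) S' n ^ ((card (rcosets\<^bsub>G\<^esub> N))\<^sup>2)))"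
proof -
  interpret G: group G by fact
  interpret finite_index_normal N G S S'
    using assms by (simp add: finite_index_normal_def finite_index_normal_axioms_def)
  have not_sub: "subgroup H G" "\<not> N \<subseteq> H" if "fg_subgroup G H" "infinite (rcosets\<^bsub>G\<^esub> H)" for H
    using that G.finite_rcosets_supergroup[OF subgroup_axioms finite_index]
    by (auto simp: fg_subgroup_def)
  show ?thesis
  proof (intro conjI allI impI)
    fix H assume H: "fg_subgroup G H" "infinite (rcosets\<^bsub>G\<^esub> H)"
    show "F_growth GN (N \<inter> H) S' \<preceq> F_growth G H S"
      by (rule F_growth_N_le[OF not_sub[OF H]])
    show "F_growth G H S \<preceq> (\<lambda>n. F_growth GN (N \<inter> H) S' n ^ (d\<^sup>2))"
      by (rule F_growth_le_power[OF not_sub[OF H]])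
  next
    assume "subgroup_separable G \<and> N \<noteq> {\<one>\<^bsub>G\<^esub>}"
    then have N: "N \<noteq> {\<one>\<^bsub>G\<^esub>}" ..
    show "Sub_growth GN S' \<preceq> Sub_growth G S"
      by (rule Sub_growth_N_le[OF N])
    show "Sub_growth G S \<preceq> (\<lambda>n. Sub_growth GN S' n ^ (d\<^sup>2))"
      by (rule Sub_growth_le_power[OF N])
  qed
qed

end
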